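(* Fix a round $t$. Assume that for each $i\in N$: (0) there is $M_i>0$ such that $a_i\mapsto c_i(a_i,a_{-i},\theta_i,\theta_{-i})$ is $M_i$-strongly convex on $\mathcal{A}_i$, uniformly in the other arguments; (a) $c_i$ is differentiable in $a_i$; (b) for each $j\ne i$ there are constants $L_{ij}^{c,0},L_{ij}^{c,1}\ge0$ such that for all $a_{-i},a_{-i}'\in\mathcal{A}_{-i}$ (and all $a_i,\theta_i,\theta_{-i}$), $|c_i(a_i,a_{-i}',\theta_i,\theta_{-i})-c_i(a_i,a_{-i},\theta_i,\theta_{-i})|\le\sum_{j\ne i}L_{ij}^{c,0}\|a_j'-a_j\|$ and $\|\nabla_{a_i}c_i(a_i,a_{-i}',\theta_i,\theta_{-i})-\nabla_{a_i}c_i(a_i,a_{-i},\theta_i,\theta_{-i})\|\le\sum_{j\neq i}L_{ij}^{c,1}\|a_j'-a_j\|$; (c) writing $C_f(\theta_{-i}):=c_i(a_i,f_{-i}(\theta_{-i}),\theta_i,\theta_{-i})$, there are $\kappa_i^{{\rm al},0},\kappa_i^{{\rm al},1}\ge0$ such that for all $f_{-i},f_{-i}'\in\mathcal{F}_{-i}$, $$\big\|\nabla_{a_i}\rho^{\rm al}_{\eta(\cdot\mid\theta_i;\zeta)}(C_f)-\nabla_{a_i}\rho^{\rm al}_{\eta(\cdot\mid\theta_i;\zeta)}(C_{f'})\big\|\le\kappa_i^{{\rm al},1}\sup_{\theta_{-i}}\|\nabla_{a_i}C_f-\nabla_{a_i}C_{f'}\|+\kappa_i^{{\rm al},0}\sup_{\theta_{-i}}|C_f-C_{f'}|,$$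 uniformly for $a_i\in\mathcal{A}_i$, $\theta_i\in\Theta_i$ and almost surely $\zeta\in\mathcal{Z}$; (d) writing $R_f(\zeta):=\rho^{\rm al}_{\eta(\cdot\mid\theta_i;\zeta)}(C_f)$, there are $\kappa_i^{{\rm ep},0},\kappa_i^{{\rm ep},1}\ge0$ such that for all $f_{-i},f_{-i}'\in\mathcal{F}_{-i}$, $$\big\|\nabla_{a_i}\rho^{\rm ep}_{\mu_i^t}(R_f)-\nabla_{a_i}\rho^{\rm ep}_{\mu_i^t}(R_{f'})\big\|\le\kappa_i^{{\rm ep},1}\sup_{\zeta\in\mathcal{Z}}\|\nabla_{a_i}R_f(\zeta)-\nabla_{a_i}R_{f'}(\zeta)\|+\kappa_i^{{\rm ep},0}\sup_{\zeta\in\mathcal{Z}}|R_f(\zeta)-R_{f'}(\zeta)|,$$ uniformly for $a_i\in\mathcal{A}_i$, $\theta_i\in\Theta_i$; (e) with $K_{ij}:=\kappa_i^{{\rm ep},1}(\kappa_i^{{\rm al},1}L_{ij}^{c,1}+\kappa_i^{{\rm al},0}L_{ij}^{c,0})+\kappa_i^{{\rm ep},0}L_{ij}^{c,0}$ for $j\ne i$, $K_{ii}:=0$, the matrix $\Gamma$ with entries $\Gamma_{ij}=K_{ij}/M_i$ has spectral radius $r(\Gamma)<1$. Then the BNE-RABL model has at most one equilibrium in round $t$.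
   Context: Game. $N=\{1,\dots,n\}$ is the set of players. For each $i\in N$ the type space $\Theta_i\subset\mathbb{R}^{d_i}$ and the action space $\mathcal{A}_i\subset\mathbb{R}^{n_i}$ are nonempty, compact and convex (standing assumption); $\Theta=\prod_j\Theta_j$, $\mathcal{A}=\prod_j\mathcal{A}_j$, and the subscript $-i$ denotes the profile or product over $j\neq i$. The loss $c_i:\mathcal{A}_i\times\mathcal{A}_{-i}\times\Theta_i\times\Theta_{-i}\to\mathbb{R}$ is continuous, hence bounded (standing assumption). $\mathcal{F}_i$ is the set of measurable functions $f_i:\Theta_i\to\mathcal{A}_i$ with the supremum norm; $\mathcal{F}=\prod_j\mathcal{F}_j$, $\mathcal{F}_{-i}=\prod_{j\ne i}\mathcal{F}_j$. $f_{-i}(\theta_{-i})=(f_j(\theta_j))_{j\neq i}$. Distributions. $\{\eta(\cdot;\zeta):\zeta\in\mathcal{Z}\}$ is a parametric family of distributions on $\Theta$ with densities $p(\theta;\zeta)$; $\eta(\cdot\mid\theta_i;\zeta)$ is the conditional distribution of $\theta_{-i}$ given $\theta_i$ under $\eta(\cdot;\zeta)$. At round $t$ player $i$ has a (prior/posterior) belief $\mu_i^t$, a probability distribution on $\mathcal{Z}$. Risk measures. A risk measure is a real functional on random losses that is monotone and cash invariant ($\rho(\xi+c)=\rho(\xi)+c$). $\rho_P$ denotes evaluation when the underlying uncertainty has distribution $P$. $\rho^{\rm al}$ is a risk measure applied to the randomness in $\theta_{-i}$, $\rho^{\rm ep}$ a risk measure applied to the randomness in $\zeta$; the nested problems are assumed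 well defined. An equilibrium of the BNE-RABL model (Bayesian Nash equilibrium among risk-averse Bayesian learners) in round $t$ is $f^{t*}\in\mathcal{F}$ such that for every $i\in N$ and every $\theta_i\in\Theta_i$, $f_i^{t*}(\theta_i)\in\arg\min_{a_i\in\mathcal{A}_i}\rho^{\rm ep}_{\mu_i^t}\big(\rho^{\rm al}_{\eta(\cdot\mid\theta_i;\zeta)}(c_i(a_i,f_{-i}^{t*}(\theta_{-i}),\theta_i,\theta_{-i}))\big)$. $M$-strong convexity of $g$: $g(\lambda a+(1-\lambda)a')\le\lambda g(a)+(1-\lambda)g(a')-\frac{M}{2}\lambda(1-\lambda)\|a-a'\|^2$ for $\lambda\in[0,1]$.
   Formalization: Both risk measures are additionally assumed convex (the claim fails for merely monotone, cash-invariant ones), and the suprema over ζ in (d) run over the same almost-sure subset of Z, fixed for each player i, on which (c) holds. *)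

theory Defs
  imports "HOL-Probability.Probability" "Jordan_Normal_Form.Spectral_Radius"
begin

text \<open>
  The players are \<open>0, \<dots>, n - 1\<close>.  All type spaces live in one Euclidean space \<open>'a\<close> and all action
  spaces in one Euclidean space \<open>'b\<close>; since the sets \<open>\<Theta>\<^sub>i\<close> and \<open>A\<^sub>i\<close> may be lower-dimensional, this
  covers spaces of different dimensions \<open>d\<^sub>i\<close> and \<open>n\<^sub>i\<close>.  Profiles over a set \<open>J\<close> of players are
  extensional functions on \<open>J\<close>.

  Densities are taken with respect to the product of the measures \<open>ref_measure G i\<close> on \<open>\<Theta>\<^sub>i\<close>.  These are
  arbitrary because Lebesgue measure on the common space \<open>'a\<close> would vanish on lower-dimensional \<open>\<Theta>\<^sub>i\<close>;
  Lebesgue measure of the proper dimension is the instance meant in the case of continuous types.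
  \<open>conditional G i x z\<close> is the conditional distribution of the types of the players other than \<open>i\<close>,
  given that \<open>i\<close> has type \<open>x\<close>, under the parameter \<open>z\<close>, and \<open>belief G t i\<close> is \<open>i\<close>'s belief in round \<open>t\<close>.
\<close>

record ('a, 'b, 'z) rabl_game =
  num_players :: nat
  type_space :: "nat \<Rightarrow> 'a set"
  action_space :: "nat \<Rightarrow> 'b set"
  loss :: "nat \<Rightarrow> 'b \<Rightarrow> (nat \<Rightarrow> 'b) \<Rightarrow> 'a \<Rightarrow> (nat \<Rightarrow> 'a) \<Rightarrow> real"
  param_space :: "'z measure"
  ref_measure :: "nat \<Rightarrow> 'a measure"
  type_density :: "'z \<Rightarrow> (nat \<Rightarrow> 'a) \<Rightarrow> real"
  conditional :: "nat \<Rightarrow> 'a \<Rightarrow> 'z \<Rightarrow> (nat \<Rightarrow> 'a) measure"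
  belief :: "nat \<Rightarrow> nat \<Rightarrow> 'z measure"
  risk_al :: "(nat \<Rightarrow> 'a) measure \<Rightarrow> ((nat \<Rightarrow> 'a) \<Rightarrow> real) \<Rightarrow> real"
  risk_ep :: "'z measure \<Rightarrow> ('z \<Rightarrow> real) \<Rightarrow> real"

definition players :: "('a, 'b, 'z) rabl_game \<Rightarrow> nat set" where
  "players G = {..<num_players G}"

definition others :: "('a, 'b, 'z) rabl_game \<Rightarrow> nat \<Rightarrow> nat set" where
  "others G i = players G - {i}"

definition other_types :: "('a, 'b, 'z) rabl_game \<Rightarrow> nat \<Rightarrow> (nat \<Rightarrow> 'a) set" where
  "other_types G i = (\<Pi>\<^sub>E j\<in>others G i. type_space G j)"

definition other_actions :: "('a, 'b, 'z) rabl_game \<Rightarrow> nat \<Rightarrow> (nat \<Rightarrow> 'b) set" where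
  "other_actions G i = (\<Pi>\<^sub>E j\<in>others G i. action_space G j)"

definition type_sigma :: "('a::topological_space, 'b, 'z) rabl_game \<Rightarrow> nat \<Rightarrow> 'a measure" where
  "type_sigma G i = restrict_space borel (type_space G i)"

definition type_dist :: "('a, 'b, 'z) rabl_game \<Rightarrow> 'z \<Rightarrow> (nat \<Rightarrow> 'a) measure" where
  "type_dist G z = density (\<Pi>\<^sub>M j\<in>players G. ref_measure G j) (\<lambda>\<theta>. ennreal (type_density G z \<theta>))"

subsection \<open>Strategies\<close>

definition strategies ::
  "('a::topological_space, 'b::topological_space, 'z) rabl_game \<Rightarrow> nat \<Rightarrow> ('a \<Rightarrow> 'b) set" where
  "strategies G i =
     (restrict_space borel (type_space G i) \<rightarrow>\<^sub>M restrict_space borel (action_space G i))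
       \<inter> extensional (type_space G i)"

definition strategy_profiles ::
  "('a::topological_space, 'b::topological_space, 'z) rabl_game \<Rightarrow> nat set \<Rightarrow> (nat \<Rightarrow> 'a \<Rightarrow> 'b) set" where
  "strategy_profiles G J = (\<Pi>\<^sub>E j\<in>J. strategies G j)"

definition play :: "nat set \<Rightarrow> (nat \<Rightarrow> 'a \<Rightarrow> 'b) \<Rightarrow> (nat \<Rightarrow> 'a) \<Rightarrow> nat \<Rightarrow> 'b" where
  "play J f \<theta> = (\<lambda>j\<in>J. f j (\<theta> j))"

subsection \<open>Conditional distributions\<close>

text \<open>
  \<open>conditional G i _ z\<close> is a regular version, defined at every type of player \<open>i\<close>, of the conditional
  distribution under \<open>type_dist G z\<close>.
\<close>

definition regular_conditional ::
  "('a::topological_space, 'b, 'z) rabl_game \<Rightarrow> nat \<Rightarrow> 'z \<Rightarrow> bool" where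
  "regular_conditional G i z \<longleftrightarrow>
     (\<lambda>x. conditional G i x z)
        \<in> type_sigma G i \<rightarrow>\<^sub>M prob_algebra (\<Pi>\<^sub>M j\<in>others G i. type_sigma G j) \<and>
     (\<forall>X\<in>sets (type_sigma G i). \<forall>Y\<in>sets (\<Pi>\<^sub>M j\<in>others G i. type_sigma G j).
        emeasure (type_dist G z)
          {\<theta> \<in> space (type_dist G z). \<theta> i \<in> X \<and> restrict \<theta> (others G i) \<in> Y} =
        (\<integral>\<^sup>+x\<in>X. emeasure (conditional G i x z) Y
           \<partial>distr (type_dist G z) (type_sigma G i) (\<lambda>\<theta>. \<theta> i)))"

subsection \<open>Risk measures\<close>

text \<open>
  All losses of the game are bounded, so the properties of a risk measure are only required on bounded
  losses.  Monotonicity is only required with respect to the pointwise order, which is implied by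
  monotonicity with respect to the almost sure order.
\<close>

definition random_losses :: "'w measure \<Rightarrow> ('w \<Rightarrow> real) set" where
  "random_losses P = {\<xi> \<in> borel_measurable P. bounded (\<xi> ` space P)}"

definition risk_measure :: "('w measure \<Rightarrow> ('w \<Rightarrow> real) \<Rightarrow> real) \<Rightarrow> bool" where
  "risk_measure \<rho> \<longleftrightarrow> (\<forall>P. prob_space P \<longrightarrow>
     (\<forall>\<xi>\<in>random_losses P. \<forall>\<xi>'\<in>random_losses P.
        (\<forall>w\<in>space P. \<xi> w \<le> \<xi>' w) \<longrightarrow> \<rho> P \<xi> \<le> \<rho> P \<xi>') \<and>
     (\<forall>\<xi>\<in>random_losses P. \<forall>c. \<rho> P (\<lambda>w. \<xi> w + c) = \<rho> P \<xi> + c))"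

definition convex_risk_measure :: "('w measure \<Rightarrow> ('w \<Rightarrow> real) \<Rightarrow> real) \<Rightarrow> bool" where
  "convex_risk_measure \<rho> \<longleftrightarrow> risk_measure \<rho> \<and> (\<forall>P. prob_space P \<longrightarrow>
     (\<forall>\<xi>\<in>random_losses P. \<forall>\<xi>'\<in>random_losses P. \<forall>l\<in>{0..1}.
        \<rho> P (\<lambda>w. l * \<xi> w + (1 - l) * \<xi>' w) \<le> l * \<rho> P \<xi> + (1 - l) * \<rho> P \<xi>'))"

subsection \<open>Nested risk and equilibria\<close>

definition loss_under ::
  "('a, 'b, 'z) rabl_game \<Rightarrow> nat \<Rightarrow> 'b \<Rightarrow> (nat \<Rightarrow> 'a \<Rightarrow> 'b) \<Rightarrow> 'a \<Rightarrow> (nat \<Rightarrow> 'a) \<Rightarrow> real" where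
  "loss_under G i a f x = (\<lambda>y. loss G i a (play (others G i) f y) x y)"

definition al_risk ::
  "('a, 'b, 'z) rabl_game \<Rightarrow> nat \<Rightarrow> 'b \<Rightarrow> (nat \<Rightarrow> 'a \<Rightarrow> 'b) \<Rightarrow> 'a \<Rightarrow> 'z \<Rightarrow> real" where
  "al_risk G i a f x = (\<lambda>z. risk_al G (conditional G i x z) (loss_under G i a f x))"

definition nested_risk ::
  "('a, 'b, 'z) rabl_game \<Rightarrow> nat \<Rightarrow> nat \<Rightarrow> 'b \<Rightarrow> (nat \<Rightarrow> 'a \<Rightarrow> 'b) \<Rightarrow> 'a \<Rightarrow> real" where
  "nested_risk G t i a f x = risk_ep G (belief G t i) (al_risk G i a f x)"

definition rabl_equilibrium ::
  "('a::topological_space, 'b::topological_space, 'z) rabl_game \<Rightarrow> nat \<Rightarrow> (nat \<Rightarrow> 'a \<Rightarrow> 'b) \<Rightarrow> bool" where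
  "rabl_equilibrium G t f \<longleftrightarrow>
     f \<in> strategy_profiles G (players G) \<and>
     (\<forall>i\<in>players G. \<forall>x\<in>type_space G i.
        is_arg_min (\<lambda>a. nested_risk G t i a (restrict f (others G i)) x)
          (\<lambda>a. a \<in> action_space G i) (f i x))"

text \<open>
  Standing assumptions.  The last clause is the well-definedness of the nested problems: the inner risk
  is a random loss in the parameter.  Boundedness is not automatic, because a risk measure need not
  vanish at the zero loss and its value there may depend on the distribution.
\<close>

definition rabl_model ::
  "('a::euclidean_space, 'b::euclidean_space, 'z) rabl_game \<Rightarrow> nat \<Rightarrow> bool" where
  "rabl_model G t \<longleftrightarrow>
     num_players G \<ge> 1 \<and>
     (\<forall>i\<in>players G. type_space G i \<noteq> {} \<and> compact (type_space G i) \<and> convex (type_space G i)) \<and>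
     (\<forall>i\<in>players G. action_space G i \<noteq> {} \<and> compact (action_space G i) \<and> convex (action_space G i)) \<and>
     (\<forall>i\<in>players G.
        continuous_on
          (action_space G i \<times> other_actions G i \<times> type_space G i \<times> other_types G i)
          (\<lambda>(a, b, x, y). loss G i a b x y)) \<and>
     (\<forall>i\<in>players G. sigma_finite_measure (ref_measure G i) \<and>
        sets (ref_measure G i) = sets (type_sigma G i)) \<and>
     (\<forall>z\<in>space (param_space G).
        type_density G z \<in> borel_measurable (\<Pi>\<^sub>M j\<in>players G. ref_measure G j) \<and>
        (\<forall>\<theta>\<in>space (\<Pi>\<^sub>M j\<in>players G. ref_measure G j). 0 \<le> type_density G z \<theta>) \<and>
        prob_space (type_dist G z)) \<and>
     (\<forall>i\<in>players G. \<forall>z\<in>space (param_space G). regular_conditional G i z) \<and>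
     (\<forall>i\<in>players G. prob_space (belief G t i) \<and> sets (belief G t i) = sets (param_space G)) \<and>
     risk_measure (risk_al G) \<and> risk_measure (risk_ep G) \<and>
     (\<forall>i\<in>players G. \<forall>a\<in>action_space G i. \<forall>x\<in>type_space G i.
        \<forall>f\<in>strategy_profiles G (others G i). al_risk G i a f x \<in> random_losses (belief G t i))"

subsection \<open>Strong convexity and gradients\<close>

definition strongly_convex_on :: "'b::real_normed_vector set \<Rightarrow> real \<Rightarrow> ('b \<Rightarrow> real) \<Rightarrow> bool" where
  "strongly_convex_on S M g \<longleftrightarrow> (\<forall>a\<in>S. \<forall>a'\<in>S. \<forall>l\<in>{0..1}.
     g (l *\<^sub>R a + (1 - l) *\<^sub>R a')
       \<le> l * g a + (1 - l) * g a' - M / 2 * l * (1 - l) * (norm (a - a'))\<^sup>2)"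

text \<open>
  \<open>D\<close> is a gradient of \<open>g\<close> at \<open>a\<close> relative to \<open>S\<close>.  It is unique if \<open>S\<close> is convex with nonempty interior,
  but not if \<open>S\<close> is lower-dimensional, hence a predicate.
\<close>

definition has_gradient :: "('b::real_inner \<Rightarrow> real) \<Rightarrow> 'b \<Rightarrow> 'b \<Rightarrow> 'b set \<Rightarrow> bool" where
  "has_gradient g D a S \<longleftrightarrow> (g has_derivative (\<lambda>h. inner h D)) (at a within S)"

end

theory Submission
  imports Defs
begin

text \<open>
  Since the risk measures are monotone, cash invariant and convex, the nested risk inherits the strong
  convexity of the loss.  At the minimisers of two strongly convex functions the first-order conditions
  give \<open>M\<^sub>i |f\<^sub>i x - g\<^sub>i x| \<le> |\<nabla>N\<^sub>f (g\<^sub>i x) - \<nabla>N\<^sub>g (g\<^sub>i x)|\<close>, where \<open>f\<close> and \<open>g\<close> are equilibria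
  and \<open>N\<^sub>f\<close> is the nested risk of player \<open>i\<close> against \<open>f\<close>.  The Lipschitz conditions then bound the vector
  \<open>d\<close> of sup-distances between \<open>f\<^sub>j\<close> and \<open>g\<^sub>j\<close> by \<open>d \<le> \<Gamma> d\<close>, and iterating this inequality forces \<open>d = 0\<close>
  because the powers of \<open>\<Gamma>\<close> tend to zero.
\<close>

section \<open>First-order conditions for strongly convex functions on a convex set\<close>

lemma has_gradient_directional_limit:
  fixes g :: "'b::real_inner \<Rightarrow> real"
  assumes D: "has_gradient g D a S" and "convex S" and "a \<in> S" "b \<in> S"
  shows "((\<lambda>l. (g (l *\<^sub>R b + (1 - l) *\<^sub>R a) - g a) / l) \<longlongrightarrow> inner (b - a) D) (at_right 0)"
proof -
  \<comment> \<open>The chain rule runs along the segment from \<open>a\<close> to \<open>b\<close>,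
    which convexity keeps inside \<open>S\<close>; hence the derivative within \<open>{0..1}\<close>
    and a one-sided limit. The limit involves \<open>D\<close> only through its inner product with
    the feasible direction \<open>b - a\<close>.\<close>
  define p where "p = (\<lambda>l::real. l *\<^sub>R b + (1 - l) *\<^sub>R a)"
  have p_S: "p ` {0..1} \<subseteq> S"
    using convexD_alt[OF \<open>convex S\<close> \<open>a \<in> S\<close> \<open>b \<in> S\<close>] by (auto simp: p_def add.commute)
  have "(p has_derivative (\<lambda>l. l *\<^sub>R (b - a))) (at 0 within {0..1})"
    unfolding p_def by (auto intro!: derivative_eq_intros simp: algebra_simps)
  moreover have "(g has_derivative (\<lambda>h. inner h D)) (at (p 0) within p ` {0..1})"
    using D has_derivative_subset[OF _ p_S] by (auto simp: has_gradient_def p_def)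
  ultimately have "(g \<circ> p has_derivative (\<lambda>h. inner h D) \<circ> (\<lambda>l. l *\<^sub>R (b - a))) (at 0 within {0..1})"
    by (rule diff_chain_within)
  then have "((g \<circ> p) has_real_derivative inner (b - a) D) (at 0 within {0..1})"
    by (simp add: has_field_derivative_def o_def mult_commute_abs)
  then show ?thesis
    by (simp add: has_field_derivative_iff at_within_Icc_at_right p_def)
qed

text \<open>Divided by \<open>l\<close>, the strong convexity inequality bounds the difference
  quotient from \<open>a\<close> towards \<open>b\<close>. As \<open>l\<close> tends to 0, the
  quotient becomes the directional derivative and the factor \<open>1 - l\<close> becomes 1.\<close>

lemma strongly_convex_on_gradient:
  fixes g :: "'b::real_inner \<Rightarrow> real"
  assumes "strongly_convex_on S M g" and "has_gradient g D a S" and "convex S" and "a \<in> S" "b \<in> S"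
  shows "g a + inner (b - a) D + M / 2 * (norm (b - a))\<^sup>2 \<le> g b"
proof -
  let ?p = "\<lambda>l::real. l *\<^sub>R b + (1 - l) *\<^sub>R a"
  have "((\<lambda>l. g b - g a - M / 2 * (1 - l) * (norm (b - a))\<^sup>2)
      \<longlongrightarrow> g b - g a - M / 2 * (1 - 0) * (norm (b - a))\<^sup>2) (at_right 0)"
    by (intro tendsto_intros)
  moreover have "eventually (\<lambda>l. (g (?p l) - g a) / l
      \<le> g b - g a - M / 2 * (1 - l) * (norm (b - a))\<^sup>2) (at_right 0)"
    using eventually_at_right_real[of 0 1, simplified]
  proof eventually_elim
    case (elim l)
    then have "g (?p l) \<le> l * g b + (1 - l) * g a - M / 2 * l * (1 - l) * (norm (b - a))\<^sup>2"
      using assms(1,4,5) by (auto simp: strongly_convex_on_def)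
    then have "g (?p l) - g a \<le> (g b - g a - M / 2 * (1 - l) * (norm (b - a))\<^sup>2) * l"
      by (simp add: algebra_simps)
    then show ?case
      using elim by (simp add: pos_divide_le_eq)
  qed
  ultimately have "inner (b - a) D \<le> g b - g a - M / 2 * (1 - 0) * (norm (b - a))\<^sup>2"
    using has_gradient_directional_limit[OF assms(2-5)] by (intro tendsto_le[OF trivial_limit_at_right_real])
  then show ?thesis by simp
qed

text \<open>A minimiser may lie on the boundary of \<open>S\<close>, so \<open>D = 0\<close> cannot
  be expected. What survives is a variational inequality: all difference quotients towards feasible
  points are nonnegative, and so is their limit.\<close>

lemma is_arg_min_gradient_nonneg:
  fixes g :: "'b::real_inner \<Rightarrow> real"
  assumes min: "is_arg_min g (\<lambda>a. a \<in> S) a" and "has_gradient g D a S" and "convex S" and "b \<in> S"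
  shows "0 \<le> inner (b - a) D"
proof -
  have "a \<in> S" and le: "\<And>y. y \<in> S \<Longrightarrow> g a \<le> g y"
    using min by (auto simp: is_arg_min_def not_less)
  have "eventually (\<lambda>l. 0 \<le> (g (l *\<^sub>R b + (1 - l) *\<^sub>R a) - g a) / l) (at_right 0)"
    using eventually_at_right_real[of 0 1, simplified]
  proof eventually_elim
    case (elim l)
    then show ?case
      using convexD_alt[OF \<open>convex S\<close> \<open>a \<in> S\<close> \<open>b \<in> S\<close>, of l]
      by (auto intro!: divide_nonneg_pos le simp: add.commute)
  qed
  then show ?thesis
    using has_gradient_directional_limit[OF assms(2,3) \<open>a \<in> S\<close> \<open>b \<in> S\<close>]
    by (intro tendsto_lowerbound[OF _ _ trivial_limit_at_right_real])
qed

text \<open>Adding the strong convexity inequalities of \<open>g\<close> at \<open>a\<close> and at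
  \<open>a'\<close> cancels the function values. The variational inequalities of the two minimisers
  then leave only gradients at the common point \<open>a'\<close>, which is the kind of difference
  that the Lipschitz conditions control.\<close>

lemma arg_min_distance_le:
  fixes g g' :: "'b::real_inner \<Rightarrow> real"
  assumes g: "is_arg_min g (\<lambda>a. a \<in> S) a" "strongly_convex_on S M g"
      "has_gradient g D a S" "has_gradient g D' a' S"
    and g': "is_arg_min g' (\<lambda>a. a \<in> S) a'" "has_gradient g' D'' a' S"
    and "convex S"
  shows "M * norm (a - a') \<le> norm (D' - D'')"
proof (cases "a = a'")
  case False
  have S: "a \<in> S" "a' \<in> S"
    using g(1) g'(1) by (auto simp: is_arg_min_def)
  have "g a + inner (a' - a) D + M / 2 * (norm (a' - a))\<^sup>2 \<le> g a'"
    "g a' + inner (a - a') D' + M / 2 * (norm (a - a'))\<^sup>2 \<le> g a"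
    using strongly_convex_on_gradient g \<open>convex S\<close> S by blast+
  moreover have "0 \<le> inner (a' - a) D" "0 \<le> inner (a - a') D''"
    using is_arg_min_gradient_nonneg g g' \<open>convex S\<close> S by blast+
  ultimately have "M * (norm (a - a'))\<^sup>2 \<le> inner (a - a') (D'' - D')"
    by (simp add: inner_diff_right norm_minus_commute)
  also have "\<dots> \<le> norm (a - a') * norm (D' - D'')"
    using norm_cauchy_schwarz[of "a - a'" "D'' - D'"] by (simp add: norm_minus_commute)
  finally have "(M * norm (a - a')) * norm (a - a') \<le> norm (D' - D'') * norm (a - a')"
    by (simp add: power2_eq_square mult_ac)
  then show ?thesis
    using False by simp
qed simp

subsection \<open>Nonnegative matrices of spectral radius less than one\<close>

text \<open>An eigenvalue \<open>e\<close> of the scaled matrix with maximal modulus gives the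
  eigenvalue \<open>e / s\<close> of \<open>A\<close>, with the same eigenvector.\<close>

lemma spectral_radius_smult_less:
  assumes A: "A \<in> carrier_mat n n" and "n > 0" and "s > 0" and "s * spectral_radius A < b"
  shows "spectral_radius (complex_of_real s \<cdot>\<^sub>m A) < b"
proof -
  have sA: "complex_of_real s \<cdot>\<^sub>m A \<in> carrier_mat n n"
    using A by simp
  obtain e where e: "e \<in> spectrum (complex_of_real s \<cdot>\<^sub>m A)"
      "spectral_radius (complex_of_real s \<cdot>\<^sub>m A) = cmod e"
    using spectral_radius_mem_max(1)[OF sA \<open>n > 0\<close>] by auto
  then obtain v where v: "v \<in> carrier_vec n" "v \<noteq> 0\<^sub>v n"
      "(complex_of_real s \<cdot>\<^sub>m A) *\<^sub>v v = e \<cdot>\<^sub>v v"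
    using A by (auto simp: spectrum_def eigenvalue_def eigenvector_def)
  have "complex_of_real s \<cdot>\<^sub>v (A *\<^sub>v v) = e \<cdot>\<^sub>v v"
    using v(1,3) A by (auto simp: vec_eq_iff)
  then have "A *\<^sub>v v = (e / of_real s) \<cdot>\<^sub>v v"
    using \<open>s > 0\<close> v(1) A by (auto simp: vec_eq_iff field_simps)
  then have "e / of_real s \<in> spectrum A"
    using v(1,2) A by (auto simp: spectrum_def eigenvalue_def eigenvector_def)
  then have "cmod (e / of_real s) \<le> spectral_radius A"
    using spectral_radius_mem_max(2)[OF A \<open>n > 0\<close>] by blast
  then have "cmod e \<le> s * spectral_radius A"
    using \<open>s > 0\<close> by (simp add: norm_divide field_simps)
  then show ?thesis
    using assms(4) e(2) by linarith
qed

text \<open>Both conjuncts need one induction: the hypothesis on \<open>s * d l\<close> is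
  multiplied by entries of row \<open>i\<close> of the current power, which preserves the inequality
  because these entries are nonnegative. The vector \<open>d\<close> may have any sign.\<close>

lemma nonneg_mat_pow_le:
  fixes B :: "real mat"
  assumes B: "B \<in> carrier_mat n n" and nonneg: "\<And>i j. i < n \<Longrightarrow> j < n \<Longrightarrow> 0 \<le> B $$ (i, j)"
    and "0 \<le> s" and le: "\<And>i. i < n \<Longrightarrow> s * d i \<le> (\<Sum>j<n. B $$ (i, j) * d j)"
    and "i < n"
  shows "(\<forall>j<n. 0 \<le> (B ^\<^sub>m k) $$ (i, j)) \<and> s ^ k * d i \<le> (\<Sum>j<n. (B ^\<^sub>m k) $$ (i, j) * d j)"
proof (induction k)
  case 0
  have "(\<Sum>j<n. 1\<^sub>m n $$ (i, j) * d j) = (\<Sum>j<n. if j = i then d i else 0)"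
    using \<open>i < n\<close> by (intro sum.cong) auto
  then show ?case
    using B \<open>i < n\<close> by simp
next
  case (Suc k)
  have entry: "(B ^\<^sub>m Suc k) $$ (i, j) = (\<Sum>l<n. (B ^\<^sub>m k) $$ (i, l) * B $$ (l, j))" if "j < n" for j
    using B \<open>i < n\<close> that by (simp add: scalar_prod_def lessThan_atLeast0)
  have "s ^ Suc k * d i \<le> s * (\<Sum>l<n. (B ^\<^sub>m k) $$ (i, l) * d l)"
    using Suc \<open>0 \<le> s\<close> by (simp add: mult.assoc mult_left_mono)
  also have "\<dots> = (\<Sum>l<n. (B ^\<^sub>m k) $$ (i, l) * (s * d l))"
    by (simp add: sum_distrib_left mult_ac)
  also have "\<dots> \<le> (\<Sum>l<n. (B ^\<^sub>m k) $$ (i, l) * (\<Sum>j<n. B $$ (l, j) * d j))"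
    using Suc le by (intro sum_mono mult_left_mono) auto
  also have "\<dots> = (\<Sum>j<n. (\<Sum>l<n. (B ^\<^sub>m k) $$ (i, l) * B $$ (l, j)) * d j)"
    by (simp add: sum_distrib_left sum_distrib_right mult.assoc) (rule sum.swap)
  also have "\<dots> = (\<Sum>j<n. (B ^\<^sub>m Suc k) $$ (i, j) * d j)"
    by (simp add: entry del: pow_mat.simps)
  finally show ?case
    using Suc nonneg by (auto simp: entry simp del: pow_mat.simps intro!: sum_nonneg mult_nonneg_nonneg)
qed

text \<open>For a suitable \<open>s > 1\<close> the powers of \<open>s A\<close> stay bounded, while
  the hypothesis iterates to a bound of \<open>s ^ k * d i\<close> by row \<open>i\<close> of the
  \<open>k\<close>-th such power applied to \<open>d\<close>. A positive \<open>d i\<close> would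
  make the left side grow without limit.\<close>

lemma spectral_radius_less_1_subinvariant:
  fixes A :: "real mat"
  assumes A: "A \<in> carrier_mat n n" and nonneg: "\<And>i j. i < n \<Longrightarrow> j < n \<Longrightarrow> 0 \<le> A $$ (i, j)"
    and spectral: "spectral_radius (map_mat complex_of_real A) < 1"
    and le: "\<And>i. i < n \<Longrightarrow> d i \<le> (\<Sum>j<n. A $$ (i, j) * d j)"
    and "i < n"
  shows "d i \<le> 0"
proof (rule ccontr)
  assume "\<not> d i \<le> 0"
  let ?r = "spectral_radius (map_mat complex_of_real A)"
  have cA: "map_mat complex_of_real A \<in> carrier_mat n n"
    using A by simp
  have "0 \<le> ?r"
    using spectral_radius_mem_max(1)[OF cA] \<open>i < n\<close> by auto
  \<comment> \<open>The powers of a matrix of spectral radius below one are only known to be bounded; applied to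
    \<open>s A\<close> with \<open>s > 1\<close>, this gives decay of the powers of \<open>A\<close>.\<close>
  define s where "s = 2 / (1 + ?r)"
  \<comment> \<open>As \<open>?r\<close> is nonnegative, each of the two inequalities for this
    \<open>s\<close> amounts to \<open>?r < 1\<close>.\<close>
  have s: "1 < s" "s * ?r < 1"
    using \<open>0 \<le> ?r\<close> spectral by (simp_all add: s_def field_simps)
  define B where "B = s \<cdot>\<^sub>m A"
  have B: "B \<in> carrier_mat n n"
    using A by (simp add: B_def)
  have cB: "map_mat complex_of_real B = complex_of_real s \<cdot>\<^sub>m map_mat complex_of_real A"
    using A by (auto simp: B_def)
  have "spectral_radius (map_mat complex_of_real B) < 1"
    unfolding cB using spectral_radius_smult_less[OF cA, of s 1] \<open>i < n\<close> s by simp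
  then obtain c where c: "\<And>k. norm_bound (map_mat complex_of_real B ^\<^sub>m k) c"
    using spectral_radius_jnf_norm_bound_less_1_upper_triangular[of "map_mat complex_of_real B" n] B
    by auto
  have bound: "\<bar>(B ^\<^sub>m k) $$ (i, j)\<bar> \<le> c" if "j < n" for j k
  proof -
    have "map_mat complex_of_real B ^\<^sub>m k = map_mat complex_of_real (B ^\<^sub>m k)"
      using B by (simp add: of_real_hom.mat_hom_pow)
    then show ?thesis
      using c[of k] B \<open>i < n\<close> that pow_carrier_mat[OF B, of k] by (auto simp: norm_bound_def)
  qed
  have "s ^ k * d i \<le> (\<Sum>j<n. c * \<bar>d j\<bar>)" for k
  proof -
    have "s ^ k * d i \<le> (\<Sum>j<n. (B ^\<^sub>m k) $$ (i, j) * d j)"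
    proof (rule nonneg_mat_pow_le[THEN conjunct2])
      show "s * d l \<le> (\<Sum>j<n. B $$ (l, j) * d j)" if "l < n" for l
        using mult_left_mono[OF le[OF that], of s] s(1) A that
        by (simp add: B_def sum_distrib_left mult.assoc)
    qed (use B A nonneg s(1) \<open>i < n\<close> in \<open>auto simp: B_def\<close>)
    also have "\<dots> \<le> (\<Sum>j<n. c * \<bar>d j\<bar>)"
    proof (rule sum_mono)
      fix j assume "j \<in> {..<n}"
      then show "(B ^\<^sub>m k) $$ (i, j) * d j \<le> c * \<bar>d j\<bar>"
        using mult_right_mono[OF bound[of j k], of "\<bar>d j\<bar>"]
          abs_ge_self[of "(B ^\<^sub>m k) $$ (i, j) * d j"] by (simp add: abs_mult)
    qed
    finally show ?thesis .
  qed
  moreover obtain k where "(\<Sum>j<n. c * \<bar>d j\<bar>) / d i < s ^ k"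
    using real_arch_pow[OF s(1)] by blast
  ultimately show False
    using \<open>\<not> d i \<le> 0\<close> by (force simp: field_simps not_le dest: leD)
qed

subsection \<open>Risk measures\<close>

lemma random_losses_affine:
  assumes "\<xi> \<in> random_losses P" "\<xi>' \<in> random_losses P"
  shows "(\<lambda>w. l * \<xi> w + m * \<xi>' w + c) \<in> random_losses P"
proof -
  obtain C C' where C: "\<And>w. w \<in> space P \<Longrightarrow> \<bar>\<xi> w\<bar> \<le> C" "\<And>w. w \<in> space P \<Longrightarrow> \<bar>\<xi>' w\<bar> \<le> C'"
    using assms by (auto simp: random_losses_def bounded_iff)
  have "\<bar>l * \<xi> w + m * \<xi>' w + c\<bar> \<le> \<bar>l\<bar> * C + \<bar>m\<bar> * C' + \<bar>c\<bar>" if "w \<in> space P" for w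
    using mult_left_mono[OF C(1)[OF that] abs_ge_zero[of l]]
      mult_left_mono[OF C(2)[OF that] abs_ge_zero[of m]]
      abs_triangle_ineq[of "l * \<xi> w + m * \<xi>' w" c] abs_triangle_ineq[of "l * \<xi> w" "m * \<xi>' w"]
    by (simp add: abs_mult)
  moreover have "(\<lambda>w. l * \<xi> w + m * \<xi>' w + c) \<in> borel_measurable P"
    using assms by (auto simp: random_losses_def)
  ultimately show ?thesis
    by (auto simp: random_losses_def bounded_iff)
qed

text \<open>Monotonicity and cash invariance enter through this combination. The constant
  \<open>c\<close> is later either a sup-distance of two losses or the negative of the quadratic
  term of strong convexity.\<close>

lemma risk_measure_le:
  assumes "risk_measure \<rho>" "prob_space P" "\<xi> \<in> random_losses P" "\<xi>' \<in> random_losses P"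
    and le: "\<And>w. w \<in> space P \<Longrightarrow> \<xi> w \<le> \<xi>' w + c"
  shows "\<rho> P \<xi> \<le> \<rho> P \<xi>' + c"
proof -
  have "(\<lambda>w. \<xi>' w + c) \<in> random_losses P"
    using random_losses_affine[OF assms(4,4), of 1 0 c] by simp
  moreover have "\<forall>\<xi>\<in>random_losses P. \<forall>\<xi>'\<in>random_losses P.
      (\<forall>w\<in>space P. \<xi> w \<le> \<xi>' w) \<longrightarrow> \<rho> P \<xi> \<le> \<rho> P \<xi>'"
    using assms(1,2) unfolding risk_measure_def by blast
  ultimately have "\<rho> P \<xi> \<le> \<rho> P (\<lambda>w. \<xi>' w + c)"
    using assms(3) le by (metis (no_types, lifting))
  also have "\<dots> = \<rho> P \<xi>' + c"
    using assms(1,2,4) by (simp add: risk_measure_def)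
  finally show ?thesis .
qed

text \<open>Risk measures are nonexpansive in the supremum norm. This is why the summand
  \<open>\<kappa>ep0 i * Lc0 i j\<close> of \<open>K i j\<close> carries no constant of the inner
  risk measure.\<close>

lemma risk_measure_diff_le:
  assumes "risk_measure \<rho>" "prob_space P" "\<xi> \<in> random_losses P" "\<xi>' \<in> random_losses P"
    and "\<And>w. w \<in> space P \<Longrightarrow> \<bar>\<xi> w - \<xi>' w\<bar> \<le> c"
  shows "\<bar>\<rho> P \<xi> - \<rho> P \<xi>'\<bar> \<le> c"
  using risk_measure_le[OF assms(1-4), of c] risk_measure_le[OF assms(1,2,4,3), of c] assms(5)
  by (fastforce simp: abs_le_iff)

text \<open>At fixed \<open>a\<close>, \<open>a'\<close> and \<open>l\<close> the quadratic term
  does not depend on the outcome, so cash invariance moves it out of the risk unchanged; convexity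
  of the risk measure handles the mixture that remains. Monotonicity and cash invariance alone would
  not suffice: the minimum over finitely many outcomes has both, yet a minimum of strongly convex
  functions need not be convex.\<close>

lemma convex_risk_measure_strongly_convex_on:
  assumes \<rho>: "convex_risk_measure \<rho>" and P: "prob_space P" and "convex S"
    and losses: "\<And>a. a \<in> S \<Longrightarrow> \<xi> a \<in> random_losses P"
    and sc: "\<And>w. w \<in> space P \<Longrightarrow> strongly_convex_on S M (\<lambda>a. \<xi> a w)"
  shows "strongly_convex_on S M (\<lambda>a. \<rho> P (\<xi> a))"
  unfolding strongly_convex_on_def
proof (intro ballI)
  fix a a' and l :: real assume a: "a \<in> S" "a' \<in> S" and l: "l \<in> {0..1}"
  let ?p = "l *\<^sub>R a + (1 - l) *\<^sub>R a'" and ?c = "M / 2 * l * (1 - l) * (norm (a - a'))\<^sup>2"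
  have "?p \<in> S"
    using convexD[OF \<open>convex S\<close> a, of l "1 - l"] l by simp
  have mix: "(\<lambda>w. l * \<xi> a w + (1 - l) * \<xi> a' w) \<in> random_losses P"
    using random_losses_affine[OF losses[OF a(1)] losses[OF a(2)], of l "1 - l" 0] by simp
  have "\<rho> P (\<xi> ?p) \<le> \<rho> P (\<lambda>w. l * \<xi> a w + (1 - l) * \<xi> a' w) + (- ?c)"
  proof (rule risk_measure_le[OF _ P losses[OF \<open>?p \<in> S\<close>] mix])
    show "risk_measure \<rho>"
      using \<rho> by (simp add: convex_risk_measure_def)
    show "\<xi> ?p w \<le> l * \<xi> a w + (1 - l) * \<xi> a' w + (- ?c)" if "w \<in> space P" for w
      using sc[OF that] a l by (simp add: strongly_convex_on_def)
  qed
  also have "\<rho> P (\<lambda>w. l * \<xi> a w + (1 - l) * \<xi> a' w) \<le> l * \<rho> P (\<xi> a) + (1 - l) * \<rho> P (\<xi> a')"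
    using \<rho> P losses a l by (simp add: convex_risk_measure_def)
  finally show "\<rho> P (\<xi> ?p) \<le> l * \<rho> P (\<xi> a) + (1 - l) * \<rho> P (\<xi> a') - ?c"
    by simp
qed

subsection \<open>Losses under a strategy profile\<close>

lemma others_subset: "others G i \<subseteq> players G"
  by (auto simp: others_def)

lemma strategies_mem: "f \<in> strategies G j \<Longrightarrow> x \<in> type_space G j \<Longrightarrow> f x \<in> action_space G j"
  by (auto simp: strategies_def dest!: measurable_space[of f _ _ x] simp: space_restrict_space)

lemma play_mem_other_actions:
  assumes "f \<in> strategy_profiles G (others G i)" "y \<in> other_types G i"
  shows "play (others G i) f y \<in> other_actions G i"
  using assms by (auto simp: play_def other_actions_def other_types_def strategy_profiles_def
      PiE_iff intro!: strategies_mem)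

text \<open>Extensionality pins the coordinates outside \<open>I\<close> to
  \<open>undefined\<close>. With singleton factors there, the set is a product over all indices and
  Tychonoff's theorem applies.\<close>

lemma compact_PiE:
  assumes "\<And>i. i \<in> I \<Longrightarrow> compact (S i :: 'b::topological_space set)"
  shows "compact (\<Pi>\<^sub>E i\<in>I. S i)"
proof -
  have "(\<Pi>\<^sub>E i\<in>I. S i) = (\<Pi>\<^sub>E i\<in>UNIV. if i \<in> I then S i else {undefined})"
    by (auto simp: PiE_iff extensional_def split: if_splits)
  moreover have "compactin (product_topology (\<lambda>i. euclidean) UNIV)
      (\<Pi>\<^sub>E i\<in>UNIV. if i \<in> I then S i else {undefined})"
    using assms by (simp add: compactin_PiE)
  ultimately show ?thesis
    by (simp add: euclidean_product_topology)
qed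

text \<open>For countably many indices and a second countable target, the Borel sets of the function
  space are those of the product sigma-algebra. This links the continuity of the loss with the
  product measures on types.\<close>

lemma borel_measurable_fun_coordinatewise:
  fixes f :: "'w \<Rightarrow> 'i::countable \<Rightarrow> 'b::second_countable_topology"
  assumes "\<And>j. (\<lambda>w. f w j) \<in> borel_measurable N"
  shows "f \<in> borel_measurable N"
proof -
  have "f \<in> N \<rightarrow>\<^sub>M (\<Pi>\<^sub>M j\<in>UNIV. borel)"
    using assms by (intro measurable_PiM_single') auto
  then show ?thesis
    by (simp add: measurable_cong_sets[OF refl sets_PiM_equal_borel])
qed

section \<open>The nested risk of one player\<close>

context
  fixes G :: "('a::euclidean_space, 'b::euclidean_space, 'z) rabl_game" and t i :: nat
  assumes model: "rabl_model G t" and i: "i \<in> players G"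
begin

lemma other_types_nonempty: "other_types G i \<noteq> {}"
  using model by (auto simp: rabl_model_def other_types_def PiE_eq_empty_iff others_def)

lemma action_space_convex: "convex (action_space G i)"
  using model i by (auto simp: rabl_model_def)

lemma prob_space_belief: "prob_space (belief G t i)"
  using model i by (auto simp: rabl_model_def)

lemma space_belief: "space (belief G t i) = space (param_space G)"
  using model i by (intro sets_eq_imp_space_eq) (auto simp: rabl_model_def)

lemma space_other_types: "space (\<Pi>\<^sub>M j\<in>others G i. type_sigma G j) = other_types G i"
  by (simp add: space_PiM other_types_def type_sigma_def space_restrict_space)

lemma conditional:
  assumes "x \<in> type_space G i" "z \<in> space (param_space G)"
  shows prob_space_conditional: "prob_space (conditional G i x z)"
    and sets_conditional: "sets (conditional G i x z) = sets (\<Pi>\<^sub>M j\<in>others G i. type_sigma G j)"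
    and space_conditional: "space (conditional G i x z) = other_types G i"
proof -
  have "(\<lambda>x. conditional G i x z)
      \<in> type_sigma G i \<rightarrow>\<^sub>M prob_algebra (\<Pi>\<^sub>M j\<in>others G i. type_sigma G j)"
    using model i assms(2) by (auto simp: rabl_model_def regular_conditional_def)
  moreover have "x \<in> space (type_sigma G i)"
    using assms(1) by (simp add: type_sigma_def space_restrict_space)
  ultimately have "conditional G i x z \<in> space (prob_algebra (\<Pi>\<^sub>M j\<in>others G i. type_sigma G j))"
    by (rule measurable_space)
  then show "prob_space (conditional G i x z)"
    and "sets (conditional G i x z) = sets (\<Pi>\<^sub>M j\<in>others G i. type_sigma G j)"
    by (auto simp: space_prob_algebra)
  then show "space (conditional G i x z) = other_types G i"
    using sets_eq_imp_space_eq space_other_types by blast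
qed

text \<open>Strategies are only measurable, so the loss is factored as a continuous function of the
  pair of others' actions and types, composed with the measurable map from \<open>y\<close> to
  \<open>(play (others G i) f y, y)\<close>. Compactness of the domain of the continuous factor
  gives boundedness.\<close>

lemma loss_under_random_losses:
  assumes a: "a \<in> action_space G i" and f: "f \<in> strategy_profiles G (others G i)"
    and x: "x \<in> type_space G i" and z: "z \<in> space (param_space G)"
  shows "loss_under G i a f x \<in> random_losses (conditional G i x z)"
proof -
  let ?N = "\<Pi>\<^sub>M j\<in>others G i. type_sigma G j"
  have cont: "continuous_on (action_space G i \<times> other_actions G i \<times> type_space G i \<times> other_types G i)
      (\<lambda>(a, b, x, y). loss G i a b x y)"
    using model i by (auto simp: rabl_model_def)
  have cont_arg: "continuous_on (other_actions G i \<times> other_types G i) (\<lambda>w. (a, fst w, x, snd w))"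
    by (intro continuous_intros)
  have "(\<lambda>w. (a, fst w, x, snd w)) ` (other_actions G i \<times> other_types G i)
      \<subseteq> action_space G i \<times> other_actions G i \<times> type_space G i \<times> other_types G i"
    using a x by auto
  from continuous_on_compose2[OF cont cont_arg this]
  have cont': "continuous_on (other_actions G i \<times> other_types G i) (\<lambda>(b, y). loss G i a b x y)"
    by (simp add: case_prod_beta)
  have "compact (other_actions G i)" "compact (other_types G i)"
    unfolding other_actions_def other_types_def
    using model others_subset[of G i] by (auto intro!: compact_PiE simp: rabl_model_def)
  then have "bounded ((\<lambda>(b, y). loss G i a b x y) ` (other_actions G i \<times> other_types G i))"
    by (intro compact_imp_bounded compact_continuous_image[OF cont'] compact_Times)
  then have "bounded (loss_under G i a f x ` other_types G i)"
    by (rule bounded_subset) (auto simp: loss_under_def play_mem_other_actions[OF f])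
  moreover have "loss_under G i a f x \<in> borel_measurable ?N"
  proof -
    have component: "(\<lambda>y. y j) \<in> ?N \<rightarrow>\<^sub>M type_sigma G j" if "j \<in> others G i" for j
      using that by measurable
    \<comment> \<open>The identity changes the target to the Borel sigma-algebra on functions of all
      indices; coordinates of indices outside \<open>others G i\<close> are constantly
      \<open>undefined\<close> on the source.\<close>
    have "(\<lambda>y. y) \<in> borel_measurable ?N"
    proof (rule borel_measurable_fun_coordinatewise)
      fix j show "(\<lambda>y. y j) \<in> borel_measurable ?N"
      proof (cases "j \<in> others G i")
        case True
        then show ?thesis
          using component[OF True] by (simp add: type_sigma_def measurable_restrict_space2_iff)
      next
        case False
        then have "(\<lambda>y. y j) \<in> borel_measurable ?N \<longleftrightarrow> (\<lambda>y. undefined::'a) \<in> borel_measurable ?N"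
          by (intro measurable_cong) (auto simp: space_other_types other_types_def PiE_iff extensional_def)
        then show ?thesis by simp
      qed
    qed
    moreover have "play (others G i) f \<in> borel_measurable ?N"
    proof (rule borel_measurable_fun_coordinatewise)
      fix j show "(\<lambda>y. play (others G i) f y j) \<in> borel_measurable ?N"
      proof (cases "j \<in> others G i")
        case True
        then have "f j \<in> strategies G j"
          using f by (auto simp: strategy_profiles_def)
        then have "f j \<in> type_sigma G j \<rightarrow>\<^sub>M borel"
          by (simp add: strategies_def type_sigma_def measurable_restrict_space2_iff)
        then show ?thesis
          using measurable_compose[OF component[OF True]] True by (simp add: play_def)
      qed (simp add: play_def)
    qed
    ultimately have "(\<lambda>y. (play (others G i) f y, y)) \<in> borel_measurable ?N"
      by (rule borel_measurable_Pair[rotated])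
    then have "(\<lambda>y. (play (others G i) f y, y))
        \<in> ?N \<rightarrow>\<^sub>M restrict_space borel (other_actions G i \<times> other_types G i)"
      using play_mem_other_actions[OF f] by (auto simp: measurable_restrict_space2_iff space_other_types)
    from measurable_compose[OF this borel_measurable_continuous_on_restrict[OF cont']]
    show ?thesis
      by (simp add: loss_under_def)
  qed
  ultimately show ?thesis
    by (simp add: random_losses_def space_conditional[OF x z]
        measurable_cong_sets[OF sets_conditional[OF x z] refl])
qed

text \<open>The transfer of strong convexity is applied twice, first to the inner risk at each
  parameter and then to the outer risk; neither application loses any of the modulus
  \<open>M\<close>.\<close>

lemma nested_risk_strongly_convex_on:
  assumes "convex_risk_measure (risk_al G)" "convex_risk_measure (risk_ep G)"
    and sc: "\<And>b y. b \<in> other_actions G i \<Longrightarrow> y \<in> other_types G i \<Longrightarrow>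
      strongly_convex_on (action_space G i) M (\<lambda>a. loss G i a b x y)"
    and f: "f \<in> strategy_profiles G (others G i)" and x: "x \<in> type_space G i"
  shows "strongly_convex_on (action_space G i) M (\<lambda>a. nested_risk G t i a f x)"
  unfolding nested_risk_def
proof (rule convex_risk_measure_strongly_convex_on[OF assms(2) prob_space_belief action_space_convex])
  show "al_risk G i a f x \<in> random_losses (belief G t i)" if "a \<in> action_space G i" for a
    using model i that f x by (auto simp: rabl_model_def)
  fix z assume "z \<in> space (belief G t i)"
  then have z: "z \<in> space (param_space G)"
    by (simp add: space_belief)
  show "strongly_convex_on (action_space G i) M (\<lambda>a. al_risk G i a f x z)"
    unfolding al_risk_def
  proof (rule convex_risk_measure_strongly_convex_on[OF assms(1) prob_space_conditional[OF x z] action_space_convex])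
    show "loss_under G i a f x \<in> random_losses (conditional G i x z)" if "a \<in> action_space G i" for a
      using loss_under_random_losses[OF that f x z] .
    show "strongly_convex_on (action_space G i) M (\<lambda>a. loss_under G i a f x y)"
      if "y \<in> space (conditional G i x z)" for y
      unfolding loss_under_def
      using that sc play_mem_other_actions[OF f] by (simp add: space_conditional[OF x z])
  qed
qed

end

section \<open>Uniqueness of the equilibrium\<close>

lemma mult_SUP_le:
  fixes f :: "'w \<Rightarrow> real"
  assumes "0 \<le> k" "W \<noteq> {}" "\<And>w. w \<in> W \<Longrightarrow> f w \<le> c"
  shows "k * (SUP w\<in>W. f w) \<le> k * c"
  using assms by (intro mult_left_mono cSUP_least)

text \<open>Relative gradients need not be unique on lower-dimensional action spaces, so they are
  given as selections \<open>grad_c\<close>, \<open>grad_R\<close> and \<open>grad_N\<close>, to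
  which the Lipschitz conditions refer. The set \<open>Z0 i\<close> is independent of action,
  strategies and type, which expresses uniformity. The suprema over parameters run over
  \<open>Z0 i\<close>, where \<open>grad_R\<close> is known to be a gradient.\<close>

theorem theorem5p2:
  fixes G :: "('a::euclidean_space, 'b::euclidean_space, 'z) rabl_game"
    and t :: nat
    and M :: "nat \<Rightarrow> real"
    and Lc0 Lc1 :: "nat \<Rightarrow> nat \<Rightarrow> real"
    and \<kappa>al0 \<kappa>al1 \<kappa>ep0 \<kappa>ep1 :: "nat \<Rightarrow> real"
    and K :: "nat \<Rightarrow> nat \<Rightarrow> real"
    and Z0 :: "nat \<Rightarrow> 'z set"
    and grad_c :: "nat \<Rightarrow> 'b \<Rightarrow> (nat \<Rightarrow> 'b) \<Rightarrow> 'a \<Rightarrow> (nat \<Rightarrow> 'a) \<Rightarrow> 'b"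
    and grad_R :: "nat \<Rightarrow> 'b \<Rightarrow> (nat \<Rightarrow> 'a \<Rightarrow> 'b) \<Rightarrow> 'a \<Rightarrow> 'z \<Rightarrow> 'b"
    and grad_N :: "nat \<Rightarrow> 'b \<Rightarrow> (nat \<Rightarrow> 'a \<Rightarrow> 'b) \<Rightarrow> 'a \<Rightarrow> 'b"
  assumes model: "rabl_model G t"
    and convex_risk: "convex_risk_measure (risk_al G)" "convex_risk_measure (risk_ep G)"
    \<comment> \<open>(0)\<close>
    and M_pos: "\<And>i. i \<in> players G \<Longrightarrow> 0 < M i"
    and strong_convexity: "\<And>i b x y. i \<in> players G \<Longrightarrow> b \<in> other_actions G i \<Longrightarrow>
      x \<in> type_space G i \<Longrightarrow> y \<in> other_types G i \<Longrightarrow>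
      strongly_convex_on (action_space G i) (M i) (\<lambda>a. loss G i a b x y)"
    \<comment> \<open>(a)\<close>
    and grad_c: "\<And>i a b x y. i \<in> players G \<Longrightarrow> a \<in> action_space G i \<Longrightarrow> b \<in> other_actions G i \<Longrightarrow>
      x \<in> type_space G i \<Longrightarrow> y \<in> other_types G i \<Longrightarrow>
      has_gradient (\<lambda>a'. loss G i a' b x y) (grad_c i a b x y) a (action_space G i)"
    \<comment> \<open>(b)\<close>
    and Lc_nonneg: "\<And>i j. i \<in> players G \<Longrightarrow> j \<in> others G i \<Longrightarrow> 0 \<le> Lc0 i j \<and> 0 \<le> Lc1 i j"
    and loss_Lipschitz: "\<And>i a b b' x y. i \<in> players G \<Longrightarrow> a \<in> action_space G i \<Longrightarrow>
      b \<in> other_actions G i \<Longrightarrow> b' \<in> other_actions G i \<Longrightarrow>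
      x \<in> type_space G i \<Longrightarrow> y \<in> other_types G i \<Longrightarrow>
      \<bar>loss G i a b' x y - loss G i a b x y\<bar> \<le> (\<Sum>j\<in>others G i. Lc0 i j * norm (b' j - b j))"
    and grad_Lipschitz: "\<And>i a b b' x y. i \<in> players G \<Longrightarrow> a \<in> action_space G i \<Longrightarrow>
      b \<in> other_actions G i \<Longrightarrow> b' \<in> other_actions G i \<Longrightarrow>
      x \<in> type_space G i \<Longrightarrow> y \<in> other_types G i \<Longrightarrow>
      norm (grad_c i a b' x y - grad_c i a b x y) \<le> (\<Sum>j\<in>others G i. Lc1 i j * norm (b' j - b j))"
    \<comment> \<open>(c); \<open>Z0 i\<close> is the almost sure set of parameters\<close>
    and Z0: "\<And>i. i \<in> players G \<Longrightarrow> Z0 i \<subseteq> space (param_space G) \<and> (AE z in belief G t i. z \<in> Z0 i)"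
    and grad_R: "\<And>i a f x z. i \<in> players G \<Longrightarrow> a \<in> action_space G i \<Longrightarrow>
      f \<in> strategy_profiles G (others G i) \<Longrightarrow> x \<in> type_space G i \<Longrightarrow> z \<in> Z0 i \<Longrightarrow>
      has_gradient (\<lambda>a'. al_risk G i a' f x z) (grad_R i a f x z) a (action_space G i)"
    and \<kappa>al_nonneg: "\<And>i. i \<in> players G \<Longrightarrow> 0 \<le> \<kappa>al0 i \<and> 0 \<le> \<kappa>al1 i"
    and al_Lipschitz: "\<And>i a f f' x z. i \<in> players G \<Longrightarrow> a \<in> action_space G i \<Longrightarrow>
      f \<in> strategy_profiles G (others G i) \<Longrightarrow> f' \<in> strategy_profiles G (others G i) \<Longrightarrow>
      x \<in> type_space G i \<Longrightarrow> z \<in> Z0 i \<Longrightarrow>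
      norm (grad_R i a f x z - grad_R i a f' x z)
        \<le> \<kappa>al1 i * (SUP y\<in>other_types G i.
              norm (grad_c i a (play (others G i) f y) x y - grad_c i a (play (others G i) f' y) x y))
          + \<kappa>al0 i * (SUP y\<in>other_types G i. \<bar>loss_under G i a f x y - loss_under G i a f' x y\<bar>)"
    \<comment> \<open>(d)\<close>
    and grad_N: "\<And>i a f x. i \<in> players G \<Longrightarrow> a \<in> action_space G i \<Longrightarrow>
      f \<in> strategy_profiles G (others G i) \<Longrightarrow> x \<in> type_space G i \<Longrightarrow>
      has_gradient (\<lambda>a'. nested_risk G t i a' f x) (grad_N i a f x) a (action_space G i)"
    and \<kappa>ep_nonneg: "\<And>i. i \<in> players G \<Longrightarrow> 0 \<le> \<kappa>ep0 i \<and> 0 \<le> \<kappa>ep1 i"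
    and ep_Lipschitz: "\<And>i a f f' x. i \<in> players G \<Longrightarrow> a \<in> action_space G i \<Longrightarrow>
      f \<in> strategy_profiles G (others G i) \<Longrightarrow> f' \<in> strategy_profiles G (others G i) \<Longrightarrow>
      x \<in> type_space G i \<Longrightarrow>
      norm (grad_N i a f x - grad_N i a f' x)
        \<le> \<kappa>ep1 i * (SUP z\<in>Z0 i. norm (grad_R i a f x z - grad_R i a f' x z))
          + \<kappa>ep0 i * (SUP z\<in>Z0 i. \<bar>al_risk G i a f x z - al_risk G i a f' x z\<bar>)"
    \<comment> \<open>(e)\<close>
    and K: "\<And>i j. K i j = (if i = j then 0
      else \<kappa>ep1 i * (\<kappa>al1 i * Lc1 i j + \<kappa>al0 i * Lc0 i j) + \<kappa>ep0 i * Lc0 i j)"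
    and spectral: "spectral_radius (Matrix.mat (num_players G) (num_players G)
      (\<lambda>(i, j). complex_of_real (K i j / M i))) < 1"
  shows "\<exists>\<^sub>\<le>\<^sub>1 f. rabl_equilibrium G t f"
proof (rule Uniq_I)
  fix f g assume f_eq: "rabl_equilibrium G t f" and g_eq: "rabl_equilibrium G t g"
  have profiles: "f \<in> strategy_profiles G (players G)" "g \<in> strategy_profiles G (players G)"
    using f_eq g_eq by (auto simp: rabl_equilibrium_def)
  then have strategies: "f j \<in> strategies G j" "g j \<in> strategies G j" if "j \<in> players G" for j
    using that by (auto simp: strategy_profiles_def)
  define d where "d = (\<lambda>j. SUP x\<in>type_space G j. norm (f j x - g j x))"
  \<comment> \<open>Compactness of the action space makes the family bounded, so that the real
    supremum \<open>d j\<close> is indeed an upper bound.\<close>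
  have d_upper: "norm (f j x - g j x) \<le> d j" if "j \<in> players G" "x \<in> type_space G j" for j x
  proof -
    have "bounded (action_space G j)"
      using model that(1) by (auto simp: rabl_model_def intro: compact_imp_bounded)
    then obtain C where C: "\<And>a. a \<in> action_space G j \<Longrightarrow> norm a \<le> C"
      by (auto simp: bounded_iff)
    have "norm (f j x - g j x) \<le> C + C" if "x \<in> type_space G j" for x
      using norm_triangle_ineq4[of "f j x" "g j x"] C[of "f j x"] C[of "g j x"]
        strategies[OF \<open>j \<in> players G\<close>] that by (force intro: strategies_mem)
    then show ?thesis
      unfolding d_def using that(2) by (intro cSUP_upper bdd_aboveI2)
  qed
  have d_step: "M i * d i \<le> (\<Sum>j\<in>others G i. K i j * d j)" if i: "i \<in> players G" for i
  proof -
    define f' where "f' = restrict f (others G i)"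
    define g' where "g' = restrict g (others G i)"
    have f': "f' \<in> strategy_profiles G (others G i)" and g': "g' \<in> strategy_profiles G (others G i)"
      using strategies others_subset[of G i] by (auto simp: f'_def g'_def strategy_profiles_def)
    have play_diff: "norm (play (others G i) f' y j - play (others G i) g' y j) \<le> d j"
      if "j \<in> others G i" "y \<in> other_types G i" for j y
      using that d_upper[of j "y j"] others_subset[of G i]
      by (auto simp: play_def f'_def g'_def other_types_def)
    \<comment> \<open>\<open>S0\<close> and \<open>S1\<close> bound the changes of the loss and of
      its gradient when \<open>f'\<close> is replaced by \<open>g'\<close>, uniformly in the types
      and in the own action.\<close>
    define S0 where "S0 = (\<Sum>j\<in>others G i. Lc0 i j * d j)"
    define S1 where "S1 = (\<Sum>j\<in>others G i. Lc1 i j * d j)"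
    have "M i * norm (f i x - g i x) \<le> (\<Sum>j\<in>others G i. K i j * d j)" if x: "x \<in> type_space G i" for x
    proof -
      \<comment> \<open>All gradients are compared at the minimiser against \<open>g'\<close>, the
        common point in \<open>arg_min_distance_le\<close>.\<close>
      let ?a = "g i x"
      have fx: "is_arg_min (\<lambda>a. nested_risk G t i a f' x) (\<lambda>a. a \<in> action_space G i) (f i x)"
        and gx: "is_arg_min (\<lambda>a. nested_risk G t i a g' x) (\<lambda>a. a \<in> action_space G i) ?a"
        using f_eq g_eq i x by (auto simp: rabl_equilibrium_def f'_def g'_def)
      have a: "f i x \<in> action_space G i" "?a \<in> action_space G i"
        using strategies[OF i] x by (auto intro: strategies_mem)
      have play: "play (others G i) f' y \<in> other_actions G i" "play (others G i) g' y \<in> other_actions G i"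
        if "y \<in> other_types G i" for y
        using that f' g' by (auto intro: play_mem_other_actions)
      have c0: "\<bar>loss_under G i ?a f' x y - loss_under G i ?a g' x y\<bar> \<le> S0"
        if y: "y \<in> other_types G i" for y
        unfolding loss_under_def S0_def
        using loss_Lipschitz[OF i a(2) play(2,1)[OF y] x y]
        by (rule order_trans) (use Lc_nonneg[OF i] play_diff[OF _ y] in \<open>auto intro!: sum_mono mult_left_mono\<close>)
      have c1: "norm (grad_c i ?a (play (others G i) f' y) x y - grad_c i ?a (play (others G i) g' y) x y) \<le> S1"
        if y: "y \<in> other_types G i" for y
        unfolding S1_def
        using grad_Lipschitz[OF i a(2) play(2,1)[OF y] x y]
        by (rule order_trans) (use Lc_nonneg[OF i] play_diff[OF _ y] in \<open>auto intro!: sum_mono mult_left_mono\<close>)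
      \<comment> \<open>The suprema over \<open>Z0 i\<close> can be bounded pointwise only if the
        set is nonempty, which full probability under the belief guarantees.\<close>
      have "Z0 i \<noteq> {}"
        using Z0[OF i] prob_space.AE_False[OF prob_space_belief[OF model i]] by auto
      have R0: "\<bar>al_risk G i ?a f' x z - al_risk G i ?a g' x z\<bar> \<le> S0" if "z \<in> Z0 i" for z
      proof -
        have z: "z \<in> space (param_space G)"
          using Z0[OF i] that by auto
        note in_losses = loss_under_random_losses[OF model i a(2) _ x z]
        have "risk_measure (risk_al G)"
          using convex_risk(1) by (simp add: convex_risk_measure_def)
        from risk_measure_diff_le[OF this prob_space_conditional[OF model i x z] in_losses[OF f'] in_losses[OF g'] c0]
        show ?thesis
          by (simp add: al_risk_def space_conditional[OF model i x z])
      qed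
      have R1: "norm (grad_R i ?a f' x z - grad_R i ?a g' x z) \<le> \<kappa>al1 i * S1 + \<kappa>al0 i * S0"
        if "z \<in> Z0 i" for z
        using al_Lipschitz[OF i a(2) f' g' x that]
        by (rule order_trans) (intro add_mono mult_SUP_le c0 c1 other_types_nonempty[OF model i];
            use \<kappa>al_nonneg[OF i] in simp)
      have "M i * norm (f i x - ?a) \<le> norm (grad_N i ?a f' x - grad_N i ?a g' x)"
      proof (rule arg_min_distance_le[OF fx _ _ _ gx _ action_space_convex[OF model i]])
        show "strongly_convex_on (action_space G i) (M i) (\<lambda>a. nested_risk G t i a f' x)"
          using nested_risk_strongly_convex_on[OF model i convex_risk strong_convexity[OF i _ x] f' x] .
      qed (use grad_N i a f' g' x in blast)+
      also have "\<dots> \<le> \<kappa>ep1 i * (\<kappa>al1 i * S1 + \<kappa>al0 i * S0) + \<kappa>ep0 i * S0"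
        using ep_Lipschitz[OF i a(2) f' g' x]
        by (rule order_trans) (intro add_mono mult_SUP_le R0 R1 \<open>Z0 i \<noteq> {}\<close>;
            use \<kappa>ep_nonneg[OF i] in simp)
      \<comment> \<open>Collecting the coefficients of each \<open>d j\<close> in \<open>S0\<close>
        and \<open>S1\<close> produces the off-diagonal formula for \<open>K i j\<close>.\<close>
      also have "\<dots> = (\<Sum>j\<in>others G i.
          (\<kappa>ep1 i * (\<kappa>al1 i * Lc1 i j + \<kappa>al0 i * Lc0 i j) + \<kappa>ep0 i * Lc0 i j) * d j)"
        by (simp add: S0_def S1_def sum_distrib_left sum.distrib algebra_simps)
      also have "\<dots> = (\<Sum>j\<in>others G i. K i j * d j)"
        by (intro sum.cong refl) (auto simp: K others_def)
      finally show ?thesis .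
    qed
    moreover have "type_space G i \<noteq> {}"
      using model i by (auto simp: rabl_model_def)
    ultimately have "d i \<le> (\<Sum>j\<in>others G i. K i j * d j) / M i"
      unfolding d_def using M_pos[OF i] by (intro cSUP_least) (auto simp: field_simps)
    then show ?thesis
      using M_pos[OF i] by (simp add: field_simps)
  qed
  let ?n = "num_players G"
  let ?A = "Matrix.mat ?n ?n (\<lambda>(i, j). K i j / M i)"
  have d_le: "d i \<le> 0" if "i < ?n" for i
  proof (rule spectral_radius_less_1_subinvariant)
    show "?A \<in> carrier_mat ?n ?n" by simp
    show "0 \<le> ?A $$ (i, j)" if "i < ?n" "j < ?n" for i j
    proof (cases "i = j")
      case False
      then have "0 \<le> K i j" "0 < M i"
        using that Lc_nonneg[of i j] \<kappa>al_nonneg[of i] \<kappa>ep_nonneg[of i] M_pos[of i]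
        by (auto simp: K players_def others_def)
      then show ?thesis using that by simp
    qed (use that K in simp)
    have "map_mat complex_of_real ?A = Matrix.mat ?n ?n (\<lambda>(i, j). complex_of_real (K i j / M i))"
      by auto
    then show "spectral_radius (map_mat complex_of_real ?A) < 1"
      using spectral by simp
    show "d i \<le> (\<Sum>j<?n. ?A $$ (i, j) * d j)" if "i < ?n" for i
    proof -
      have i: "i \<in> players G"
        using that by (simp add: players_def)
      \<comment> \<open>Since \<open>K i i = 0\<close>, the sum over the other players extends to
        all players, as the matrix product requires.\<close>
      have "M i * d i \<le> (\<Sum>j<?n. K i j * d j)"
        using d_step[OF i] that K[of i i]
        by (simp add: others_def players_def sum_diff1)
      then have "d i \<le> (\<Sum>j<?n. K i j * d j) / M i"
        using M_pos[OF i] by (simp add: field_simps)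
      then show ?thesis
        using that by (simp add: sum_divide_distrib)
    qed
  qed fact
  show "f = g"
  proof (rule PiE_ext[OF profiles[unfolded strategy_profiles_def]])
    fix j assume j: "j \<in> players G"
    show "f j = g j"
    \<comment> \<open>Strategies are extensional, so vanishing sup-distance on the type space gives
      equality as functions.\<close>
    proof (rule extensionalityI[of _ "type_space G j"])
      show "f j \<in> extensional (type_space G j)" "g j \<in> extensional (type_space G j)"
        using strategies[OF j] by (auto simp: strategies_def)
      show "f j x = g j x" if "x \<in> type_space G j" for x
        using order_trans[OF d_upper[OF j that] d_le] j by (simp add: players_def)
    qed
  qed
qed

end
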